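(* Let $\delta,\kappa\in\{1,i\}$ and $a\in\mathbb{R}$. If $w$ is a solution of the sinh-Gordon type equation $$w_{xx}-\delta^2w_{yy}=\frac{2a}{\kappa}\sinh(2\kappa w)$$ of the form $$\sinh\left(\kappa w(x,y)\right)=\tan\left(\kappa\left(A(x)+B(y)\right)\right),$$ then the functions $A(x)$ and $B(y)$ satisfy the differential equations $$A''(x)^2=-\kappa^2A'(x)^4+c_1A'(x)^2+c_2,$$ $$B''(y)^2=-\kappa^2B'(y)^4+\delta^2(c_1-8a)B'(y)^2+c_3,$$ where $16a^2+\kappa^2(c_3-c_2)=4ac_1$ and $c_1,c_2,c_3\in\mathbb{R}$ are constants.
   Context: Here $i$ is the imaginary unit, $w=w(x,y)$ is a function of two real variables, $A$ is a function of $x$ only and $B$ is a function of $y$ only. For $\kappa=1$ the right-hand side of the PDE is $2a\sinh(2w)$ and for $\kappa=i$ it is $2a\sin(2w)$; $\delta^2=1$ gives the wave operator and $\delta^2=-1$ the Laplace operator. *)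

theory Defs
  imports "HOL-Analysis.Analysis"
begin

text \<open>For open \<open>S\<close> this is ordinary twofold differentiability; \<open>deriv f\<close> is then the genuine
  derivative of \<open>f\<close> throughout a neighbourhood of each point of \<open>S\<close>.\<close>

definition twice_differentiable_on :: "(real \<Rightarrow> real) \<Rightarrow> real set \<Rightarrow> bool"
    (infix "twice'_differentiable'_on" 50) where
  "f twice_differentiable_on S \<longleftrightarrow>
     (\<forall>x\<in>S. f differentiable (at x) \<and> deriv f differentiable (at x))"

text \<open>Classical real-valued solutions on \<open>D\<close> of
  \<open>w_xx - \<delta>\<^sup>2 w_yy = (2 a / \<kappa>) sinh (2 \<kappa> w)\<close>. The equation is stated in the complex numbers
  because \<open>\<delta>\<close> and \<open>\<kappa>\<close> may be the imaginary unit. Only the partial derivatives that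
  occur in the equation are required to exist; in particular every twice continuously
  differentiable solution is covered.\<close>

definition sinh_Gordon_solution ::
    "(real \<times> real) set \<Rightarrow> complex \<Rightarrow> complex \<Rightarrow> real \<Rightarrow> (real \<Rightarrow> real \<Rightarrow> real) \<Rightarrow> bool" where
  "sinh_Gordon_solution D \<delta> \<kappa> a w \<longleftrightarrow>
     (\<forall>y. (\<lambda>x. w x y) twice_differentiable_on {x. (x, y) \<in> D}) \<and>
     (\<forall>x. (\<lambda>y. w x y) twice_differentiable_on {y. (x, y) \<in> D}) \<and>
     (\<forall>(x, y)\<in>D.
        complex_of_real (deriv (deriv (\<lambda>s. w s y)) x)
          - \<delta>\<^sup>2 * complex_of_real (deriv (deriv (\<lambda>t. w x t)) y)
        = 2 * complex_of_real a / \<kappa> * sinh (2 * \<kappa> * complex_of_real (w x y)))"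

end

theory Submission
  imports Defs
begin

text \<open>Write \<open>e = \<kappa>\<^sup>2\<close>, \<open>d = \<delta>\<^sup>2\<close>, \<open>p = A'\<close>, \<open>q = B'\<close> and let \<open>\<tau>\<close> be \<open>tan\<close> (\<open>\<kappa> = 1\<close>) or \<open>tanh\<close>
  (\<open>\<kappa> = \<i>\<close>) at \<open>A + B\<close>, so that \<open>\<tau>' = 1 + e \<tau>\<^sup>2\<close>. Substituting the ansatz, the PDE becomes
  \<open>p' - d q' = - G \<tau>\<close> with \<open>G = e (p\<^sup>2 - d q\<^sup>2) - 4 a\<close>, which also shows that \<open>p'\<close> and \<open>q'\<close> are
  differentiable. The function \<open>K = - G - e (p' + d q') \<tau> + 2 e p\<^sup>2\<close> satisfies
  \<open>p'' = p (K - 2 e p\<^sup>2)\<close> and \<open>q'' = q (d (K - 8 a) - 2 e q\<^sup>2)\<close>, and its gradient vanishes by the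
  reduced PDE. Hence \<open>K\<close> is a constant \<open>c1\<close>, and integrating the two equations gives \<open>c2\<close> and \<open>c3\<close>;
  the relation between the constants is the product \<open>K G\<close> evaluated at one point. Working with \<open>K\<close>
  instead of the separated quotient \<open>p'' / p\<close> avoids all case distinctions on the zeros of \<open>p\<close>,
  \<open>q\<close> and \<open>G\<close>.\<close>

section \<open>Sections of the domain and twofold differentiation of the ansatz\<close>

lemma open_horizontal_section:
  assumes "open (D :: (real \<times> real) set)"
  shows "open {x. (x, y) \<in> D}"
proof -
  have "{x. (x, y) \<in> D} = (\<lambda>x. (x, y)) -` D" by auto
  moreover have "continuous_on UNIV (\<lambda>x::real. (x, y))" by (intro continuous_intros)
  ultimately show ?thesis using assms by (simp add: open_vimage)
qed

lemma open_vertical_section: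
  assumes "open (D :: (real \<times> real) set)"
  shows "open {y. (x, y) \<in> D}"
proof -
  have "{y. (x, y) \<in> D} = Pair x -` D" by auto
  moreover have "continuous_on UNIV (Pair x :: real \<Rightarrow> _)" by (intro continuous_intros)
  ultimately show ?thesis using assms by (simp add: open_vimage)
qed

lemma twice_differentiable_onD:
  assumes "f twice_differentiable_on S" "x \<in> S"
  shows "(f has_real_derivative deriv f x) (at x)"
    and "(deriv f has_real_derivative deriv (deriv f) x) (at x)"
  using assms
  by (auto simp: twice_differentiable_on_def DERIV_deriv_iff_real_differentiable)

text \<open>Differentiating \<open>s (f x) = \<tau> (g x)\<close> twice. Here \<open>(s, s')\<close> stands for
  \<open>(sinh, cosh)\<close> or \<open>(sin, cos)\<close> and \<open>\<tau>\<close> for \<open>tan\<close> or \<open>tanh\<close>; the sign \<open>e\<close> is \<open>\<kappa>\<^sup>2\<close>.\<close>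

lemma second_derivative_of_substitution:
  fixes s s' \<tau> f g g1 g2 :: "real \<Rightarrow> real" and e :: real
  assumes "open U" "f twice_differentiable_on U"
    and g: "\<And>t. t \<in> U \<Longrightarrow> (g has_real_derivative g1 t) (at t)"
    and g1: "\<And>t. t \<in> U \<Longrightarrow> (g1 has_real_derivative g2 t) (at t)"
    and s: "\<And>t. (s has_real_derivative s' t) (at t)"
    and s': "\<And>t. (s' has_real_derivative e * s t) (at t)"
    and s'_sq: "\<And>t. (s' t)\<^sup>2 = 1 + e * (s t)\<^sup>2"
    and \<tau>: "\<And>t. t \<in> U \<Longrightarrow> (\<tau> has_real_derivative 1 + e * (\<tau> (g t))\<^sup>2) (at (g t))"
    and nz: "\<And>t. t \<in> U \<Longrightarrow> 1 + e * (\<tau> (g t))\<^sup>2 \<noteq> 0"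
    and eq: "\<And>t. t \<in> U \<Longrightarrow> s (f t) = \<tau> (g t)"
    and x: "x \<in> U"
  shows "s' (f x) * deriv (deriv f) x
           = (1 + e * (\<tau> (g x))\<^sup>2) * (g2 x + e * \<tau> (g x) * (g1 x)\<^sup>2)"
proof -
  note f = twice_differentiable_onD[OF assms(2)]
  \<comment> \<open>This is needed on all of \<open>U\<close>, not only at \<open>x\<close>, because
    the identity is differentiated once more below.\<close>
  have first: "s' (f t) * deriv f t = (1 + e * (\<tau> (g t))\<^sup>2) * g1 t" if t: "t \<in> U" for t
  proof -
    have "((\<lambda>t. s (f t)) has_real_derivative s' (f t) * deriv f t) (at t)"
      by (rule DERIV_chain2[OF s f(1)[OF t]])
    moreover have "((\<lambda>t. \<tau> (g t)) has_real_derivative (1 + e * (\<tau> (g t))\<^sup>2) * g1 t) (at t)"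
      by (rule DERIV_chain2[OF \<tau>[OF t] g[OF t]])
    then have "((\<lambda>t. s (f t)) has_real_derivative (1 + e * (\<tau> (g t))\<^sup>2) * g1 t) (at t)"
      by (rule has_field_derivative_transform_within_open[OF _ \<open>open U\<close> t]) (simp add: eq)
    ultimately show ?thesis by (rule DERIV_unique)
  qed
  define m where "m = 1 + e * (\<tau> (g x))\<^sup>2"
  define T where "T = \<tau> (g x)"
  have L: "((\<lambda>t. s' (f t) * deriv f t) has_real_derivative
          e * s (f x) * deriv f x * deriv f x + s' (f x) * deriv (deriv f) x) (at x)"
    by (rule derivative_eq_intros DERIV_chain2[OF s' f(1)[OF x]] f(2)[OF x] refl)+ simp
  have "((\<lambda>t. (1 + e * (\<tau> (g t))\<^sup>2) * g1 t) has_real_derivative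
          2 * e * T * m * g1 x * g1 x + m * g2 x) (at x)"
    by (rule derivative_eq_intros DERIV_chain2[OF \<tau>[OF x] g[OF x]] g1[OF x] refl)+
      (simp add: m_def T_def algebra_simps)
  then have "((\<lambda>t. s' (f t) * deriv f t) has_real_derivative
          2 * e * T * m * g1 x * g1 x + m * g2 x) (at x)"
    by (rule has_field_derivative_transform_within_open[OF _ \<open>open U\<close> x]) (simp add: first)
  from DERIV_unique[OF L this] have second:
    "e * T * (deriv f x)\<^sup>2 + s' (f x) * deriv (deriv f) x
       = 2 * e * T * m * (g1 x)\<^sup>2 + m * g2 x"
    by (simp add: eq[OF x] T_def power2_eq_square)
  have sq: "(s' (f x))\<^sup>2 = m"
    using s'_sq[of "f x"] by (simp add: eq[OF x] m_def)
  \<comment> \<open>Squaring \<open>first\<close> turns \<open>s'\<close> into its square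
    \<open>m\<close>, so \<open>deriv f x\<close> can be eliminated after cancelling the nonzero
    factor \<open>m\<close>.\<close>
  have "m * (deriv f x)\<^sup>2 = (s' (f x) * deriv f x)\<^sup>2"
    by (simp add: power_mult_distrib sq)
  also have "\<dots> = m * (m * (g1 x)\<^sup>2)"
    by (simp add: first[OF x] m_def power_mult_distrib power2_eq_square)
  finally have "(deriv f x)\<^sup>2 = m * (g1 x)\<^sup>2"
    using nz[OF x] by (simp add: m_def)
  with second have "s' (f x) * deriv (deriv f) x = m * (g2 x + e * T * (g1 x)\<^sup>2)"
    by (simp add: algebra_simps)
  then show ?thesis
    unfolding m_def T_def .
qed

section \<open>One-variable equations: third derivatives and first integrals\<close>

text \<open>The right-hand side of \<open>ode\<close> contains only \<open>f\<close> and
  \<open>deriv f\<close>, so it is differentiable, and hence so is the second derivative. This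
  serves the reduced PDE with one variable frozen: \<open>b\<close> is then the value of the other
  function, and \<open>\<alpha>\<close>, \<open>\<gamma>\<close> collect its derivatives.\<close>

lemma third_derivative_bootstrap:
  fixes f \<tau> :: "real \<Rightarrow> real" and \<alpha> \<beta> \<gamma> b e :: real
  assumes "open U" "f twice_differentiable_on U"
    and \<tau>: "\<And>t. t \<in> U \<Longrightarrow> (\<tau> has_real_derivative 1 + e * (\<tau> (f t + b))\<^sup>2) (at (f t + b))"
    and ode: "\<And>t. t \<in> U \<Longrightarrow>
          deriv (deriv f) t = \<alpha> + (\<beta> * (deriv f t)\<^sup>2 + \<gamma>) * \<tau> (f t + b)"
    and x: "x \<in> U"
  shows "(deriv (deriv f) has_real_derivative
           2 * \<beta> * deriv f x * deriv (deriv f) x * \<tau> (f x + b)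
           + (\<beta> * (deriv f x)\<^sup>2 + \<gamma>) * deriv f x * (1 + e * (\<tau> (f x + b))\<^sup>2)) (at x)"
proof -
  note f = twice_differentiable_onD[OF assms(2) x]
  have g: "((\<lambda>t. f t + b) has_real_derivative deriv f x) (at x)"
    by (rule derivative_eq_intros f(1) refl)+ simp
  have "((\<lambda>t. \<alpha> + (\<beta> * (deriv f t)\<^sup>2 + \<gamma>) * \<tau> (f t + b)) has_real_derivative
           2 * \<beta> * deriv f x * deriv (deriv f) x * \<tau> (f x + b)
           + (\<beta> * (deriv f x)\<^sup>2 + \<gamma>) * deriv f x * (1 + e * (\<tau> (f x + b))\<^sup>2)) (at x)"
    by (rule derivative_eq_intros f(2) DERIV_chain2[OF \<tau>[OF x] g] refl)+
      (simp add: algebra_simps)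
  then show ?thesis
    by (rule has_field_derivative_transform_within_open[OF _ \<open>open U\<close> x]) (simp add: ode)
qed

text \<open>Multiplying the equation by twice the second derivative makes it exact: the energy
  \<open>E\<close> has zero derivative, and connectedness of \<open>I\<close> makes it a single
  constant.\<close>

lemma first_integral:
  fixes f :: "real \<Rightarrow> real" and e c :: real
  assumes "open I" "connected I" "f twice_differentiable_on I"
    and ode: "\<And>x. x \<in> I \<Longrightarrow>
          (deriv (deriv f) has_real_derivative c * deriv f x - 2 * e * deriv f x ^ 3) (at x)"
  shows "\<exists>k. \<forall>x\<in>I. (deriv (deriv f) x)\<^sup>2 = - e * deriv f x ^ 4 + c * (deriv f x)\<^sup>2 + k"
proof -
  define E where "E x = (deriv (deriv f) x)\<^sup>2 + e * deriv f x ^ 4 - c * (deriv f x)\<^sup>2" for x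
  have E': "(E has_real_derivative 0) (at x)" if x: "x \<in> I" for x
    unfolding E_def
    by (rule derivative_eq_intros ode[OF x] twice_differentiable_onD(2)[OF assms(3) x] refl)+
      (simp add: algebra_simps power2_eq_square power3_eq_cube)
  have "E constant_on I"
    by (rule has_field_derivative_0_imp_constant_on[OF E' assms(2,1)])
  then obtain k where k: "E x = k" if "x \<in> I" for x
    unfolding constant_on_def by blast
  have "(deriv (deriv f) x)\<^sup>2 = - e * deriv f x ^ 4 + c * (deriv f x)\<^sup>2 + k" if "x \<in> I" for x
    using k[OF that] by (simp add: E_def)
  then show ?thesis by blast
qed

section \<open>Separation constants of the reduced PDE\<close>

text \<open>About \<open>\<tau>\<close> only its Riccati equation is assumed, and about
  \<open>e\<close> and \<open>d\<close> only that their squares are 1, so one argument covers all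
  choices of \<open>\<kappa>\<close> and \<open>\<delta>\<close>.\<close>

lemma separation_constants:
  fixes A B \<tau> :: "real \<Rightarrow> real" and D :: "(real \<times> real) set" and e d a :: real
  assumes e: "e\<^sup>2 = 1" and d: "d\<^sup>2 = 1" and "open D" "connected D"
    and A: "A twice_differentiable_on (fst ` D)"
    and B: "B twice_differentiable_on (snd ` D)"
    and \<tau>: "\<And>x y. (x, y) \<in> D \<Longrightarrow>
          (\<tau> has_real_derivative 1 + e * (\<tau> (A x + B y))\<^sup>2) (at (A x + B y))"
    and eq: "\<And>x y. (x, y) \<in> D \<Longrightarrow> deriv (deriv A) x - d * deriv (deriv B) y
          = - (e * ((deriv A x)\<^sup>2 - d * (deriv B y)\<^sup>2) - 4 * a) * \<tau> (A x + B y)"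
  shows "\<exists>c1 c2 c3. 16 * a\<^sup>2 + e * (c3 - c2) = 4 * a * c1 \<and>
     (\<forall>x \<in> fst ` D. (deriv (deriv A) x)\<^sup>2
          = - e * deriv A x ^ 4 + c1 * (deriv A x)\<^sup>2 + c2) \<and>
     (\<forall>y \<in> snd ` D. (deriv (deriv B) y)\<^sup>2
          = - e * deriv B y ^ 4 + d * (c1 - 8 * a) * (deriv B y)\<^sup>2 + c3)"
proof (cases "D = {}")
  case True
  then show ?thesis
    \<comment> \<open>On the empty domain only the relation between the constants remains; it holds
      for \<open>c1 = 4 * a\<close> with \<open>c2 = c3\<close>.\<close>
    by (intro exI[of _ "4 * a"] exI[of _ 0]) (simp add: power2_eq_square)
next
  case False
  then obtain x0 y0 where z0: "(x0, y0) \<in> D" by auto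
  note DA = twice_differentiable_onD[OF A] and DB = twice_differentiable_onD[OF B]
  define p q P Q where "p = deriv A" and "q = deriv B"
    and "P = deriv (deriv A)" and "Q = deriv (deriv B)"
  note pq_defs = p_def q_def P_def Q_def
  define G where "G x y = e * ((p x)\<^sup>2 - d * (q y)\<^sup>2) - 4 * a" for x y
  define T where "T x y = \<tau> (A x + B y)" for x y
  define K where "K x y = - G x y - e * (P x + d * Q y) * T x y + 2 * e * (p x)\<^sup>2" for x y
  have ee: "e * e = 1" and dd: "d * d = 1"
    using e d by (simp_all add: power2_eq_square)
  have PQ: "P x - d * Q y = - G x y * T x y" if "(x, y) \<in> D" for x y
    using eq[OF that] by (simp add: pq_defs G_def T_def)

  have P': "(P has_real_derivative p x * (K x y - 2 * e * (p x)\<^sup>2)) (at x)"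
    if xy: "(x, y) \<in> D" for x y
  proof -
    let ?U = "{x. (x, y) \<in> D}"
    have "?U \<subseteq> fst ` D" by force
    then have A': "A twice_differentiable_on ?U"
      using A by (auto simp: twice_differentiable_on_def)
    \<comment> \<open>The reduced PDE with \<open>y\<close> frozen, solved for the second derivative
      of \<open>A\<close>.\<close>
    have ode: "deriv (deriv A) t = d * Q y + (- e * (deriv A t)\<^sup>2 + (e * d * (q y)\<^sup>2 + 4 * a)) * \<tau> (A t + B y)"
      if "t \<in> ?U" for t
      using eq[of t y] that by (simp add: pq_defs algebra_simps)
    have "(P has_real_derivative
           2 * (- e) * p x * P x * T x y
           + (- e * (p x)\<^sup>2 + (e * d * (q y)\<^sup>2 + 4 * a)) * p x * (1 + e * (T x y)\<^sup>2)) (at x)"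
      unfolding P_def p_def T_def
      by (rule third_derivative_bootstrap[OF open_horizontal_section[OF \<open>open D\<close>] A' _ ode])
        (use \<tau> xy in auto)
    moreover have "2 * (- e) * p x * P x * T x y
           + (- e * (p x)\<^sup>2 + (e * d * (q y)\<^sup>2 + 4 * a)) * p x * (1 + e * (T x y)\<^sup>2)
        = p x * (K x y - 2 * e * (p x)\<^sup>2)"
    proof -
      have G: "- e * (p x)\<^sup>2 + (e * d * (q y)\<^sup>2 + 4 * a) = - G x y"
        by (simp add: G_def algebra_simps)
      \<comment> \<open>Replacing \<open>G * T\<close> by \<open>d * Q - P\<close> in the term with
        \<open>T\<close> squared turns \<open>2 * P\<close> into the symmetric
        \<open>P + d * Q\<close>, which is what lets the same \<open>K\<close> serve both
        variables.\<close>
      show ?thesis unfolding G K_def using PQ[OF xy] by algebra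
    qed
    ultimately show ?thesis by simp
  qed

  have Q': "(Q has_real_derivative q y * (d * (K x y - 8 * a) - 2 * e * (q y)\<^sup>2)) (at y)"
    if xy: "(x, y) \<in> D" for x y
  proof -
    let ?U = "{y. (x, y) \<in> D}"
    have "?U \<subseteq> snd ` D" by force
    then have B': "B twice_differentiable_on ?U"
      using B by (auto simp: twice_differentiable_on_def)
    have ode: "deriv (deriv B) t = d * P x + (- e * (deriv B t)\<^sup>2 + d * (e * (p x)\<^sup>2 - 4 * a)) * \<tau> (B t + A x)"
      if "t \<in> ?U" for t
    proof -
      have "deriv (deriv A) x - d * deriv (deriv B) t
          = - (e * ((deriv A x)\<^sup>2 - d * (deriv B t)\<^sup>2) - 4 * a) * \<tau> (B t + A x)"
        using eq[of x t] that by (simp add: add.commute)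
      \<comment> \<open>Solving for the second derivative of \<open>B\<close> divides by
        \<open>d\<close>, which is multiplication by \<open>d\<close> since
        \<open>d * d = 1\<close>.\<close>
      with dd show ?thesis unfolding pq_defs by algebra
    qed
    have "(Q has_real_derivative
           2 * (- e) * q y * Q y * \<tau> (B y + A x)
           + (- e * (q y)\<^sup>2 + d * (e * (p x)\<^sup>2 - 4 * a)) * q y * (1 + e * (\<tau> (B y + A x))\<^sup>2)) (at y)"
      unfolding Q_def q_def
      by (rule third_derivative_bootstrap[OF open_vertical_section[OF \<open>open D\<close>] B' _ ode])
        (use \<tau> xy in \<open>auto simp: add.commute\<close>)
    moreover have "2 * (- e) * q y * Q y * \<tau> (B y + A x)
           + (- e * (q y)\<^sup>2 + d * (e * (p x)\<^sup>2 - 4 * a)) * q y * (1 + e * (\<tau> (B y + A x))\<^sup>2)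
        = q y * (d * (K x y - 8 * a) - 2 * e * (q y)\<^sup>2)"
    proof -
      have G: "- e * (q y)\<^sup>2 + d * (e * (p x)\<^sup>2 - 4 * a) = d * G x y"
        using dd unfolding G_def by algebra
      have T: "\<tau> (B y + A x) = T x y" by (simp add: T_def add.commute)
      \<comment> \<open>The shift by \<open>8 * a\<close> originates here: exchanging
        \<open>2 * e * p\<^sup>2\<close> for \<open>2 * e * d * q\<^sup>2\<close> costs
        \<open>2 * G + 8 * a\<close>.\<close>
      have K: "K x y - 8 * a = G x y + 2 * e * d * (q y)\<^sup>2 - e * (P x + d * Q y) * T x y"
        by (simp add: K_def G_def algebra_simps)
      show ?thesis unfolding G T K using PQ[OF xy] dd by algebra
    qed
    ultimately show ?thesis by simp
  qed

  have "((\<lambda>z. K (fst z) (snd z)) has_derivative (\<lambda>h. 0)) (at z)" if zD: "z \<in> D" for z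
  proof -
    obtain x y where z: "z = (x, y)" and xy: "(x, y) \<in> D"
      using zD by (cases z) auto
    have x: "x \<in> fst ` D" and y: "y \<in> snd ` D" using xy by force+
    define P1 Q1 where "P1 = p x * (K x y - 2 * e * (p x)\<^sup>2)"
      and "Q1 = q y * (d * (K x y - 8 * a) - 2 * e * (q y)\<^sup>2)"
    have fst: "((\<lambda>z. f (fst z)) has_derivative (\<lambda>h. f' * fst h)) (at z)"
      if "(f has_real_derivative f') (at x)" for f f'
      using has_derivative_compose[of fst fst z UNIV f "(*) f'"] that
      by (simp add: z has_field_derivative_def has_derivative_fst)
    have snd: "((\<lambda>z. f (snd z)) has_derivative (\<lambda>h. f' * snd h)) (at z)"
      if "(f has_real_derivative f') (at y)" for f f'
      using has_derivative_compose[of snd snd z UNIV f "(*) f'"] that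
      by (simp add: z has_field_derivative_def has_derivative_snd)
    have p: "((\<lambda>z. p (fst z)) has_derivative (\<lambda>h. P x * fst h)) (at z)"
      and P: "((\<lambda>z. P (fst z)) has_derivative (\<lambda>h. P1 * fst h)) (at z)"
      and A: "((\<lambda>z. A (fst z)) has_derivative (\<lambda>h. p x * fst h)) (at z)"
      using DA[OF x] P'[OF xy] by (auto intro!: fst simp: pq_defs P1_def)
    have q: "((\<lambda>z. q (snd z)) has_derivative (\<lambda>h. Q y * snd h)) (at z)"
      and Q: "((\<lambda>z. Q (snd z)) has_derivative (\<lambda>h. Q1 * snd h)) (at z)"
      and B: "((\<lambda>z. B (snd z)) has_derivative (\<lambda>h. q y * snd h)) (at z)"
      using DB[OF y] Q'[OF xy] by (auto intro!: snd simp: pq_defs Q1_def)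
    have T: "((\<lambda>z. T (fst z) (snd z)) has_derivative
        (\<lambda>h. (1 + e * (T x y)\<^sup>2) * (p x * fst h + q y * snd h))) (at z)"
      using has_derivative_compose[OF has_derivative_add[OF A B], of \<tau> "(*) (1 + e * (T x y)\<^sup>2)"]
        \<tau>[OF xy] by (simp add: T_def z has_field_derivative_def)
    have "((\<lambda>z. K (fst z) (snd z)) has_derivative
        (\<lambda>h. - (e * (2 * p x * P x * fst h - d * (2 * q y * Q y * snd h)))
          - (e * (P1 * fst h + d * (Q1 * snd h)) * T x y
             + e * (P x + d * Q y) * ((1 + e * (T x y)\<^sup>2) * (p x * fst h + q y * snd h)))
          + 4 * e * p x * P x * fst h)) (at z)"
      unfolding K_def G_def
      by (rule derivative_eq_intros p q P Q T refl)+ (simp add: z algebra_simps)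
    moreover have "- (e * (2 * p x * P x * u - d * (2 * q y * Q y * v)))
          - (e * (P1 * u + d * (Q1 * v)) * T x y
             + e * (P x + d * Q y) * ((1 + e * (T x y)\<^sup>2) * (p x * u + q y * v)))
          + 4 * e * p x * P x * u = 0" for u v
    proof -
      have P1: "P1 = p x * (- G x y - e * (P x + d * Q y) * T x y)"
        by (simp add: P1_def K_def)
      have "Q1 = q y * (d * (G x y + 2 * e * d * (q y)\<^sup>2 - e * (P x + d * Q y) * T x y) - 2 * e * (q y)\<^sup>2)"
        by (simp add: Q1_def K_def G_def algebra_simps)
      then have Q1: "d * Q1 = q y * (G x y - e * (P x + d * Q y) * T x y)"
        using dd by algebra
      \<comment> \<open>Up to the factor \<open>e\<close>, \<open>u\<close> and \<open>v\<close> are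
        the two partial derivatives of \<open>K\<close>. The terms with \<open>T\<close> squared
        cancel, leaving the reduced PDE times \<open>p\<close> or \<open>-q\<close>.\<close>
      have u: "2 * p x * P x - P1 * T x y - (P x + d * Q y) * (1 + e * (T x y)\<^sup>2) * p x = 0"
        unfolding P1 using PQ[OF xy] by algebra
      have v: "2 * d * q y * Q y - d * Q1 * T x y - (P x + d * Q y) * (1 + e * (T x y)\<^sup>2) * q y = 0"
        unfolding Q1 using PQ[OF xy] by algebra
      show ?thesis using u v by algebra
    qed
    ultimately show ?thesis by simp
  qed
  then have K_const: "K x y = K x0 y0" if "(x, y) \<in> D" for x y
    using has_derivative_zero_unique_connected[OF \<open>open D\<close> \<open>connected D\<close>,
        of "\<lambda>z. K (fst z) (snd z)" "(x, y)" "(x0, y0)"] z0 that by simp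
  define c1 where "c1 = K x0 y0"

  \<comment> \<open>The first integrals are taken on the projections of \<open>D\<close>, which are
    connected although sections of \<open>D\<close> need not be. Since \<open>K\<close> is constant,
    any point of \<open>D\<close> above \<open>x\<close> or beside \<open>y\<close> yields the same
    equation.\<close>
  have "open (fst ` D)" "open (snd ` D)"
    using \<open>open D\<close> by (simp_all add: open_image_fst open_image_snd)
  moreover have "connected (fst ` D)" "connected (snd ` D)"
    using \<open>connected D\<close> by (auto intro!: connected_continuous_image continuous_intros)
  moreover have "(deriv (deriv A) has_real_derivative c1 * deriv A x - 2 * e * deriv A x ^ 3) (at x)"
    if x: "x \<in> fst ` D" for x
  proof -
    obtain y where xy: "(x, y) \<in> D" using x by auto
    show ?thesis
      using P'[OF xy] by (simp add: K_const[OF xy] c1_def pq_defs algebra_simps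
          power2_eq_square power3_eq_cube)
  qed
  moreover have "(deriv (deriv B) has_real_derivative
      d * (c1 - 8 * a) * deriv B y - 2 * e * deriv B y ^ 3) (at y)"
    if y: "y \<in> snd ` D" for y
  proof -
    obtain x where xy: "(x, y) \<in> D" using y by auto
    show ?thesis
      using Q'[OF xy] by (simp add: K_const[OF xy] c1_def pq_defs algebra_simps
          power2_eq_square power3_eq_cube)
  qed
  ultimately obtain c2 c3 where
    c2: "\<forall>x\<in>fst ` D. (P x)\<^sup>2 = - e * p x ^ 4 + c1 * (p x)\<^sup>2 + c2" and
    c3: "\<forall>y\<in>snd ` D. (Q y)\<^sup>2 = - e * q y ^ 4 + d * (c1 - 8 * a) * (q y)\<^sup>2 + c3"
    using first_integral[OF _ _ A, of c1 e] first_integral[OF _ _ B, of "d * (c1 - 8 * a)" e]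
    unfolding pq_defs by metis
  have "x0 \<in> fst ` D" "y0 \<in> snd ` D" using z0 by force+
  with c2 c3 have z0_eqs:
    "(P x0)\<^sup>2 = - e * p x0 ^ 4 + c1 * (p x0)\<^sup>2 + c2"
    "(Q y0)\<^sup>2 = - e * q y0 ^ 4 + d * (c1 - 8 * a) * (q y0)\<^sup>2 + c3"
    by auto
  \<comment> \<open>In \<open>K * G\<close> the reduced PDE replaces \<open>G * T\<close> by
    \<open>d * Q - P\<close>, so the mixed term becomes a difference of squares. Inserting the first
    integrals then cancels every power of \<open>p\<close> and \<open>q\<close>.\<close>
  have "c1 * G x0 y0 = - (G x0 y0)\<^sup>2 + e * ((P x0)\<^sup>2 - (Q y0)\<^sup>2) + 2 * e * (p x0)\<^sup>2 * G x0 y0"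
    unfolding c1_def K_def using PQ[OF z0] dd by algebra
  then have "16 * a\<^sup>2 + e * (c3 - c2) = 4 * a * c1"
    using z0_eqs ee dd unfolding G_def by algebra
  with c2 c3 show ?thesis unfolding pq_defs by blast
qed

section \<open>Reduction of the PDE by the ansatz\<close>

text \<open>Multiplied by \<open>s' (w x y)\<close>, both second derivatives of \<open>w\<close>
  acquire the factor \<open>m\<close>, and so does the source term because \<open>m\<close> is the
  square of \<open>s'\<close>. Cancelling \<open>m\<close>, nonzero by \<open>nz\<close>, removes
  \<open>w\<close> from the equation.\<close>

lemma separated_equation:
  fixes A B \<tau> s s' :: "real \<Rightarrow> real" and w :: "real \<Rightarrow> real \<Rightarrow> real"
    and D :: "(real \<times> real) set" and e d a :: real
  assumes "open D" and xy: "(x, y) \<in> D"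
    and A: "A twice_differentiable_on (fst ` D)"
    and B: "B twice_differentiable_on (snd ` D)"
    and wx: "(\<lambda>x. w x y) twice_differentiable_on {x. (x, y) \<in> D}"
    and wy: "(\<lambda>y. w x y) twice_differentiable_on {y. (x, y) \<in> D}"
    and pde: "deriv (deriv (\<lambda>x. w x y)) x - d * deriv (deriv (\<lambda>y. w x y)) y
          = 4 * a * s (w x y) * s' (w x y)"
    and s: "\<And>t. (s has_real_derivative s' t) (at t)"
    and s': "\<And>t. (s' has_real_derivative e * s t) (at t)"
    and s'_sq: "\<And>t. (s' t)\<^sup>2 = 1 + e * (s t)\<^sup>2"
    and \<tau>: "\<And>x y. (x, y) \<in> D \<Longrightarrow>
          (\<tau> has_real_derivative 1 + e * (\<tau> (A x + B y))\<^sup>2) (at (A x + B y))"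
    and nz: "\<And>x y. (x, y) \<in> D \<Longrightarrow> 1 + e * (\<tau> (A x + B y))\<^sup>2 \<noteq> 0"
    and eq: "\<And>x y. (x, y) \<in> D \<Longrightarrow> s (w x y) = \<tau> (A x + B y)"
  shows "deriv (deriv A) x - d * deriv (deriv B) y
          = - (e * ((deriv A x)\<^sup>2 - d * (deriv B y)\<^sup>2) - 4 * a) * \<tau> (A x + B y)"
proof -
  define T where "T = \<tau> (A x + B y)"
  define m where "m = 1 + e * T\<^sup>2"
  have A': "((\<lambda>t. A t + B y) has_real_derivative deriv A t) (at t)"
      "(deriv A has_real_derivative deriv (deriv A) t) (at t)" if "t \<in> {x. (x, y) \<in> D}" for t
  proof -
    have "t \<in> fst ` D" using that by force
    from twice_differentiable_onD[OF A this]
    show "((\<lambda>t. A t + B y) has_real_derivative deriv A t) (at t)"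
      "(deriv A has_real_derivative deriv (deriv A) t) (at t)"
      by (auto intro!: derivative_eq_intros)
  qed
  have B': "((\<lambda>t. A x + B t) has_real_derivative deriv B t) (at t)"
      "(deriv B has_real_derivative deriv (deriv B) t) (at t)" if "t \<in> {y. (x, y) \<in> D}" for t
  proof -
    have "t \<in> snd ` D" using that by force
    from twice_differentiable_onD[OF B this]
    show "((\<lambda>t. A x + B t) has_real_derivative deriv B t) (at t)"
      "(deriv B has_real_derivative deriv (deriv B) t) (at t)"
      by (auto intro!: derivative_eq_intros)
  qed
  have wxx: "s' (w x y) * deriv (deriv (\<lambda>x. w x y)) x
      = m * (deriv (deriv A) x + e * T * (deriv A x)\<^sup>2)"
    unfolding m_def T_def
    by (rule second_derivative_of_substitution[OF open_horizontal_section[OF \<open>open D\<close>] wx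
          A' s s' s'_sq]) (use \<tau> nz eq xy in auto)
  have wyy: "s' (w x y) * deriv (deriv (\<lambda>y. w x y)) y
      = m * (deriv (deriv B) y + e * T * (deriv B y)\<^sup>2)"
    unfolding m_def T_def
    by (rule second_derivative_of_substitution[OF open_vertical_section[OF \<open>open D\<close>] wy
          B' s s' s'_sq]) (use \<tau> nz eq xy in auto)
  have "(s' (w x y))\<^sup>2 = m" "s (w x y) = T"
    using s'_sq[of "w x y"] eq[OF xy] by (simp_all add: m_def T_def)
  then have "s' (w x y) * (4 * a * s (w x y) * s' (w x y)) = m * (4 * a * T)"
    by (simp add: power2_eq_square)
  then have "s' (w x y) * deriv (deriv (\<lambda>x. w x y)) x
      - d * (s' (w x y) * deriv (deriv (\<lambda>y. w x y)) y) = m * (4 * a * T)"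
    unfolding pde[symmetric] by (simp add: algebra_simps)
  then have "m * (deriv (deriv A) x - d * deriv (deriv B) y)
      = m * (- (e * ((deriv A x)\<^sup>2 - d * (deriv B y)\<^sup>2) - 4 * a) * T)"
    unfolding wxx wyy by (simp add: algebra_simps)
  then show ?thesis
    using nz[OF xy] by (simp add: m_def T_def)
qed

section \<open>Passage from complex to real form for the two values of
  \<open>\<kappa>\<close>\<close>

lemma complex_sinh_of_real: "sinh (complex_of_real t) = of_real (sinh t)"
  by (simp add: sinh_field_def exp_of_real flip: of_real_minus)

lemma complex_cosh_of_real: "cosh (complex_of_real t) = of_real (cosh t)"
  by (simp add: cosh_field_def exp_of_real flip: of_real_minus)

theorem theorem6:
  fixes \<delta> \<kappa> :: complex and a :: real
    and D :: "(real \<times> real) set"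
    and w :: "real \<Rightarrow> real \<Rightarrow> real" and A B :: "real \<Rightarrow> real"
  assumes "\<delta> \<in> {1, \<i>}" and "\<kappa> \<in> {1, \<i>}"
    and "open D" and "connected D"
    and "sinh_Gordon_solution D \<delta> \<kappa> a w"
    and "A twice_differentiable_on (fst ` D)"
    and "B twice_differentiable_on (snd ` D)"
    and "\<And>x y. (x, y) \<in> D \<Longrightarrow> cos (\<kappa> * complex_of_real (A x + B y)) \<noteq> 0"
    and "\<And>x y. (x, y) \<in> D \<Longrightarrow>
           sinh (\<kappa> * complex_of_real (w x y)) = tan (\<kappa> * complex_of_real (A x + B y))"
  shows "\<exists>c1 c2 c3 :: real.
     16 * (complex_of_real a)\<^sup>2 + \<kappa>\<^sup>2 * (complex_of_real c3 - complex_of_real c2)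
       = 4 * complex_of_real a * complex_of_real c1 \<and>
     (\<forall>x \<in> fst ` D.
        (complex_of_real (deriv (deriv A) x))\<^sup>2
          = - \<kappa>\<^sup>2 * (complex_of_real (deriv A x)) ^ 4
            + complex_of_real c1 * (complex_of_real (deriv A x))\<^sup>2 + complex_of_real c2) \<and>
     (\<forall>y \<in> snd ` D.
        (complex_of_real (deriv (deriv B) y))\<^sup>2
          = - \<kappa>\<^sup>2 * (complex_of_real (deriv B y)) ^ 4
            + \<delta>\<^sup>2 * complex_of_real (c1 - 8 * a) * (complex_of_real (deriv B y))\<^sup>2
            + complex_of_real c3)"
proof -
  note SG = \<open>sinh_Gordon_solution D \<delta> \<kappa> a w\<close>
    and A = \<open>A twice_differentiable_on (fst ` D)\<close>
    and B = \<open>B twice_differentiable_on (snd ` D)\<close>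
  define d where "d = Re (\<delta>\<^sup>2)"
  define e where "e = Re (\<kappa>\<^sup>2)"
  have d: "\<delta>\<^sup>2 = of_real d" "d\<^sup>2 = 1"
    using assms(1) by (auto simp: d_def)
  have e: "\<kappa>\<^sup>2 = of_real e" "e\<^sup>2 = 1"
    using assms(2) by (auto simp: e_def)
  have wx: "(\<lambda>x. w x y) twice_differentiable_on {x. (x, y) \<in> D}"
    and wy: "(\<lambda>y. w x y) twice_differentiable_on {y. (x, y) \<in> D}" for x y
    using SG by (auto simp: sinh_Gordon_solution_def)
  have pde: "complex_of_real (deriv (deriv (\<lambda>s. w s y)) x - d * deriv (deriv (\<lambda>t. w x t)) y)
        = 2 * complex_of_real a / \<kappa> * sinh (2 * \<kappa> * complex_of_real (w x y))"
    if "(x, y) \<in> D" for x y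
    using SG that by (auto simp: sinh_Gordon_solution_def d(1))

  have "\<exists>\<tau>. (\<forall>(x, y)\<in>D. (\<tau> has_real_derivative 1 + e * (\<tau> (A x + B y))\<^sup>2) (at (A x + B y))) \<and>
      (\<forall>(x, y)\<in>D. deriv (deriv A) x - d * deriv (deriv B) y
          = - (e * ((deriv A x)\<^sup>2 - d * (deriv B y)\<^sup>2) - 4 * a) * \<tau> (A x + B y))"
  proof (cases "\<kappa> = 1")
    case True
    then have e1: "e = 1" by (simp add: e_def)
    \<comment> \<open>The tangent has genuine derivative \<open>1 + tan\<^sup>2\<close> only away
      from the zeros of the cosine, which the hypothesis excludes.\<close>
    have "cos (A x + B y) \<noteq> 0" if "(x, y) \<in> D" for x y
      using assms(8)[OF that] unfolding True mult_1 cos_of_real by simp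
    then have \<tau>: "(tan has_real_derivative 1 + e * (tan (A x + B y))\<^sup>2) (at (A x + B y))"
      if "(x, y) \<in> D" for x y
      using that by (auto intro!: derivative_eq_intros simp: e1 tan_sec power_inverse)
    have eq: "sinh (w x y) = tan (A x + B y)" if "(x, y) \<in> D" for x y
      using assms(9)[OF that]
      unfolding True mult_1 tan_of_real[symmetric] complex_sinh_of_real of_real_eq_iff .
    have pde': "deriv (deriv (\<lambda>x. w x y)) x - d * deriv (deriv (\<lambda>y. w x y)) y
        = 4 * a * sinh (w x y) * cosh (w x y)" if "(x, y) \<in> D" for x y
    proof -
      have arg: "2 * \<i> * complex_of_real (w x y) = \<i> * of_real (2 * w x y)"
        by simp
      have coeff: "2 * complex_of_real a / \<i> * (\<i> * of_real v) = of_real (2 * a * v)" for v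
        by simp
      have "complex_of_real (deriv (deriv (\<lambda>s. w s y)) x - d * deriv (deriv (\<lambda>t. w x t)) y)
          = of_real (4 * a * sinh (w x y) * cosh (w x y))"
        unfolding pde[OF that] by (simp add: True sinh_double complex_sinh_of_real complex_cosh_of_real)
      then show ?thesis unfolding of_real_eq_iff .
    qed
    have "deriv (deriv A) x - d * deriv (deriv B) y
          = - (e * ((deriv A x)\<^sup>2 - d * (deriv B y)\<^sup>2) - 4 * a) * tan (A x + B y)"
      if "(x, y) \<in> D" for x y
      by (rule separated_equation[where s = sinh and s' = cosh and w = w,
            OF \<open>open D\<close> that A B wx wy pde'[OF that] _ _ _ \<tau> _ eq])
        (auto intro!: derivative_eq_intros simp: e1 cosh_square_eq add_nonneg_eq_0_iff)
    with \<tau> show ?thesis by (intro exI[of _ tan]) auto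
  next
    case False
    then have \<kappa>: "\<kappa> = \<i>" using assms(2) by simp
    then have e1: "e = -1" by (simp add: e_def)
    have \<tau>: "(tanh has_real_derivative 1 + e * (tanh t)\<^sup>2) (at t)" for t
      by (auto intro!: derivative_eq_intros simp: e1)
    have nz: "1 + e * (tanh t)\<^sup>2 \<noteq> 0" for t :: real
      using tanh_real_bounds[of t] by (auto simp: e1 power2_eq_1_iff)
    have sinh_i: "sinh (\<i> * of_real t) = \<i> * of_real (sin t)" for t
      by (simp add: sinh_conv_sin sin_of_real)
    have tan_i: "tan (\<i> * of_real t) = \<i> * of_real (tanh t)" for t
      by (simp add: tan_conv_tanh tanh_def complex_sinh_of_real complex_cosh_of_real)
    have eq: "sin (w x y) = tanh (A x + B y)" if "(x, y) \<in> D" for x y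
      using assms(9)[OF that] unfolding \<kappa> sinh_i tan_i by simp
    have pde': "deriv (deriv (\<lambda>x. w x y)) x - d * deriv (deriv (\<lambda>y. w x y)) y
        = 4 * a * sin (w x y) * cos (w x y)" if "(x, y) \<in> D" for x y
    proof -
      have arg: "2 * \<i> * complex_of_real (w x y) = \<i> * of_real (2 * w x y)"
        by simp
      \<comment> \<open>The factor \<open>\<i>\<close> from the hyperbolic sine of an imaginary
        argument cancels the division by \<open>\<kappa>\<close>, so the source term is
        real.\<close>
      have coeff: "2 * complex_of_real a / \<i> * (\<i> * of_real v) = of_real (2 * a * v)" for v
        by simp
      have "complex_of_real (deriv (deriv (\<lambda>s. w s y)) x - d * deriv (deriv (\<lambda>t. w x t)) y)
          = of_real (4 * a * sin (w x y) * cos (w x y))"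
        unfolding pde[OF that] \<kappa> arg sinh_i coeff sin_double by (simp add: mult.assoc)
      then show ?thesis unfolding of_real_eq_iff .
    qed
    have "deriv (deriv A) x - d * deriv (deriv B) y
          = - (e * ((deriv A x)\<^sup>2 - d * (deriv B y)\<^sup>2) - 4 * a) * tanh (A x + B y)"
      if "(x, y) \<in> D" for x y
      by (rule separated_equation[where s = sin and s' = cos and w = w,
            OF \<open>open D\<close> that A B wx wy pde'[OF that] _ _ _ \<tau> nz eq])
        (auto intro!: derivative_eq_intros simp: e1 cos_squared_eq)
    with \<tau> show ?thesis by (intro exI[of _ tanh]) auto
  qed
  then obtain \<tau> where
    \<tau>: "\<And>x y. (x, y) \<in> D \<Longrightarrow>
        (\<tau> has_real_derivative 1 + e * (\<tau> (A x + B y))\<^sup>2) (at (A x + B y))" and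
    eq: "\<And>x y. (x, y) \<in> D \<Longrightarrow> deriv (deriv A) x - d * deriv (deriv B) y
          = - (e * ((deriv A x)\<^sup>2 - d * (deriv B y)\<^sup>2) - 4 * a) * \<tau> (A x + B y)"
    by blast
  \<comment> \<open>Each complex identity is collected into an equality of two embedded reals, so
    injectivity of \<open>of_real\<close> reduces the goal to the real statement.\<close>
  show ?thesis
    using separation_constants[OF e(2) d(2) \<open>open D\<close> \<open>connected D\<close> A B \<tau> eq]
    unfolding d(1) e(1) of_real_power[symmetric] of_real_mult[symmetric] of_real_diff[symmetric]
      of_real_add[symmetric] of_real_minus[symmetric] of_real_numeral[symmetric, where 'a = complex]
      of_real_eq_iff .
qed

end
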